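(* Let $(X,d)$ be a metric space and let $K$ be a nonempty subset of $X$. Let $A,B,S,T:K\to K$ be selfmaps of $K$. Assume that there exists $\phi\in\Phi$ such that, for some $p,\lambda>0$ and $r,q\geq 0$, the following holds for all $x,y\in K$: $$ \begin{aligned} \big[(d(Sx,Ty))^p + r\, (d(Sx,Ty))^q\big]^\lambda \leq \phi\Big(\max\big\{&[(d(Ax,By))^p + r\, (d(Ax,Sx))^q]^\lambda,\ [(d(Ax,By))^p + r\, (d(By,Ty))^q]^\lambda,\\ &[(d(Ax,Sx))^p + r\, (d(By,Ty))^q]^\lambda,\ [(d(By,Ty))^p + r\, (d(Ax,Sx))^q]^\lambda,\\ &\min\{[(d(By,Sx))^p + r\, (d(Ax,Sx))^q]^\lambda,\ [(d(Ax,Ty))^p + r\, (d(By,Ty))^q]^\lambda\},\\ &\min\{[(d(By,Sx))^p + r\, (d(By,Ty))^q]^\lambda,\ [(d(Ax,Ty))^p + r\, (d(Ax,Sx))^q]^\lambda\}\big\}\Big). \end{aligned} $$ Assume also that the pairs of selfmaps $(A,S)$ and $(B,T)$ are weakly compatible, and that $T(K)\subset A(K)$ and $S(K)\subset B(K)$. If either $T(K)$ or $S(K)$ or $A(K)$ or $B(K)$ is complete, then $A$, $B$, $S$ and $T$ have a unique common fixed point.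
   Context: $\mathbb{R}_+=[0,\infty)$. $\Phi$ denotes the set of all functions $\phi:\mathbb{R}_+\to\mathbb{R}_+$ such that (i) $\phi$ is monotonically increasing and continuous; (ii) $0<\phi(t)<t$ for all $t>0$. Two selfmaps $F,G$ of a metric space are called weakly compatible if they commute at their coincidence points: whenever $Fx=Gx$, one has $FGx=GFx$. A subset is complete if it is a complete metric space under the restriction of $d$. A common fixed point of $A,B,S,T$ is a point $z\in K$ with $Az=Bz=Sz=Tz=z$. *)

theory Defs
  imports Complex_Main
begin

(* The powers are x^a for real x, a >= 0 with the usual convention x^0 = 1, also at x = 0.
   The library's powr satisfies 0 powr 0 = 0, which matters here because the exponent q
   may be 0 while the distances may vanish. *)
definition rpow :: "real \<Rightarrow> real \<Rightarrow> real" where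
  "rpow x a = (if a = 0 then 1 else x powr a)"

(* "Monotonically increasing" is read as nondecreasing. Only the values on [0, infinity)
   matter. *)
definition Phi :: "(real \<Rightarrow> real) set" where
  "Phi = {\<phi>. \<phi> ` {0..} \<subseteq> {0..} \<and> mono_on {0..} \<phi> \<and> continuous_on {0..} \<phi> \<and>
              (\<forall>t>0. 0 < \<phi> t \<and> \<phi> t < t)}"

definition weakly_compatible_on :: "'a set \<Rightarrow> ('a \<Rightarrow> 'a) \<Rightarrow> ('a \<Rightarrow> 'a) \<Rightarrow> bool" where
  "weakly_compatible_on K F G \<longleftrightarrow> (\<forall>x\<in>K. F x = G x \<longrightarrow> F (G x) = G (F x))"

definition bracket :: "real \<Rightarrow> real \<Rightarrow> real \<Rightarrow> real \<Rightarrow> real \<Rightarrow> real \<Rightarrow> real" where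
  "bracket p q r l a b = rpow (rpow a p + r * rpow b q) l"

end

theory Submission
  imports Defs "HOL-Analysis.Elementary_Metric_Spaces"
begin

text \<open>
  With \<open>h t = bracket p q r l t t\<close>, every entry of the maximum is at most \<open>h m\<close>, where \<open>m\<close> is the
  maximum of \<open>d (A x) (B y)\<close>, \<open>d (A x) (S x)\<close>, \<open>d (B y) (T y)\<close> and
  \<open>min (d (B y) (S x)) (d (A x) (T y))\<close>. Since \<open>\<phi> (h \<epsilon>) < h \<epsilon>\<close> for \<open>\<epsilon> > 0\<close>, continuity at \<open>\<epsilon>\<close> yields
  a condition of Meir--Keeler type: there is \<open>\<delta> > 0\<close> such that \<open>m < \<epsilon> + \<delta>\<close> forces
  \<open>d (S x) (T y) < \<epsilon> - \<delta>\<close>. Continuity is used only away from \<open>0\<close>, so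
  the convention \<open>0\<^sup>0 = 1\<close>, which makes \<open>h 0 > 0\<close> for \<open>q = 0 < r\<close>, needs no separate case.
  The Meir--Keeler argument makes the alternating Jungck sequence
  \<open>A x\<^sub>0, S x\<^sub>0 = B x\<^sub>1, T x\<^sub>1 = A x\<^sub>2, \<dots>\<close> Cauchy, and its limit is the fixed point.
\<close>

section \<open>Relations of Meir-Keeler type and Cauchy sequences\<close>

definition quad :: "'a::metric_space \<Rightarrow> 'a \<Rightarrow> 'a \<Rightarrow> 'a \<Rightarrow> real" where
  "quad a b s t = max (max (dist a b) (dist a s)) (max (dist b t) (min (dist b s) (dist a t)))"

text \<open>Using a relation instead of maps lets the condition also cover the union of a relation
  with its swapped copy. The conclusion \<open>e - \<delta>\<close>, rather than \<open>e\<close>,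
  leaves a gap that survives passage to limits.\<close>

definition contractive :: "('a::metric_space \<Rightarrow> 'a \<Rightarrow> 'a \<Rightarrow> 'a \<Rightarrow> bool) \<Rightarrow> bool" where
  "contractive R \<longleftrightarrow> (\<forall>e>0. \<exists>\<delta>>0. \<forall>a b s t. R a b s t \<longrightarrow> quad a b s t < e + \<delta> \<longrightarrow> dist s t < e - \<delta>)"

lemma quad_swap: "quad b a t s = quad a b s t"
  by (simp add: quad_def dist_commute[of b a] ac_simps)

lemma quad_nonneg: "0 \<le> quad a b s t"
  by (simp add: quad_def le_max_iff_disj)

lemma contractiveE:
  assumes "contractive R" "e > 0"
  obtains \<delta> where "\<delta> > 0"
    "\<And>a b s t. R a b s t \<Longrightarrow> quad a b s t < e + \<delta> \<Longrightarrow> dist s t < e - \<delta>"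
  using assms unfolding contractive_def by blast

text \<open>If \<open>dist s t\<close> were positive, taking it as the level \<open>e\<close> would
  force it strictly below itself.\<close>

lemma contractive_eqI:
  assumes "contractive R" "R a b s t" "quad a b s t \<le> dist s t"
  shows "s = t"
proof (rule ccontr)
  assume "s \<noteq> t"
  then have "dist s t > 0" by simp
  then obtain \<delta> where "\<delta> > 0"
    "\<And>a b s' t'. R a b s' t' \<Longrightarrow> quad a b s' t' < dist s t + \<delta> \<Longrightarrow> dist s' t' < dist s t - \<delta>"
    using contractiveE[OF assms(1)] by metis
  from this(1) this(2)[OF assms(2)] assms(3) show False by linarith
qed

text \<open>Step lengths first decrease to \<open>0\<close>. Only indices of opposite parity are
  related, so the induction runs over odd gaps; an even gap costs one extra step.\<close>

lemma contractive_alternating_Cauchy: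
  fixes y :: "nat \<Rightarrow> 'a::metric_space"
  assumes R: "contractive R"
    and alt: "\<And>i j. odd (i + j) \<Longrightarrow> R (y i) (y j) (y (Suc i)) (y (Suc j))"
  shows "Cauchy y"
proof -
  define d where "d n = dist (y n) (y (Suc n))" for n
  \<comment> \<open>The inner minimum vanishes: its entry \<open>dist b s\<close> joins
    \<open>y (Suc n)\<close> to itself.\<close>
  have quad_succ: "quad (y n) (y (Suc n)) (y (Suc n)) (y (Suc (Suc n))) = max (d n) (d (Suc n))" for n
    unfolding quad_def d_def by (simp add: min_def max_def)
  have R_succ: "R (y n) (y (Suc n)) (y (Suc n)) (y (Suc (Suc n)))" for n
    by (rule alt) simp
  have d_nonneg: "0 \<le> d n" for n by (simp add: d_def)
  have d_mono: "d (Suc n) \<le> d n" for n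
  proof (rule ccontr)
    assume "\<not> d (Suc n) \<le> d n"
    then have "y (Suc n) = y (Suc (Suc n))"
      by (intro contractive_eqI[OF R R_succ]) (simp add: quad_succ, simp add: d_def)
    then show False using \<open>\<not> d (Suc n) \<le> d n\<close> by (simp add: d_def)
  qed
  then have "decseq d" by (simp add: decseq_Suc_iff)
  then obtain L where L: "d \<longlonglongrightarrow> L" "\<And>i. L \<le> d i"
    using decseq_convergent[of d 0] d_nonneg by metis
  have "L = 0"
  proof (rule ccontr)
    assume "L \<noteq> 0"
    then have "L > 0"
      using LIMSEQ_le_const[OF L(1)] d_nonneg by (metis order_le_less)
    \<comment> \<open>At level \<open>L\<close>, a step length close enough to \<open>L\<close>
      pushes the next one below \<open>L\<close>, although \<open>L\<close> bounds all of them from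
      below.\<close>
    then obtain \<delta> where \<delta>: "\<delta> > 0"
      "\<And>a b s t. R a b s t \<Longrightarrow> quad a b s t < L + \<delta> \<Longrightarrow> dist s t < L - \<delta>"
      using contractiveE[OF R] by metis
    from order_tendstoD(2)[OF L(1), of "L + \<delta>"] \<delta>(1) obtain n where "d n < L + \<delta>"
      by (auto simp: eventually_sequentially)
    then have "d (Suc n) < L - \<delta>"
      using \<delta>(2)[OF R_succ[of n]] d_mono[of n] by (simp add: quad_succ d_def)
    with L(2)[of "Suc n"] \<delta>(1) show False by linarith
  qed
  show ?thesis
  proof (rule metric_CauchyI)
    fix e' :: real assume "e' > 0"
    define e where "e = e' / 2"
    have "e > 0" using \<open>e' > 0\<close> by (simp add: e_def)
    then obtain \<delta> where \<delta>: "\<delta> > 0"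
      "\<And>a b s t. R a b s t \<Longrightarrow> quad a b s t < e + \<delta> \<Longrightarrow> dist s t < e - \<delta>"
      using contractiveE[OF R] by metis
    \<comment> \<open>The induction below overshoots \<open>e\<close> by up to
      \<open>2 * \<eta>\<close>, hence \<open>\<delta> / 2\<close>. The bound \<open>e\<close>
      serves gaps of length one and the extra step of even gaps.\<close>
    define \<eta> where "\<eta> = min (\<delta> / 2) e"
    have \<eta>: "\<eta> > 0" "2 * \<eta> \<le> \<delta>" "\<eta> \<le> e" using \<delta>(1) \<open>e > 0\<close> by (auto simp: \<eta>_def)
    from order_tendstoD(2)[OF L(1), of \<eta>] \<eta>(1) \<open>L = 0\<close> obtain N where N: "\<And>n. n \<ge> N \<Longrightarrow> d n < \<eta>"
      by (auto simp: eventually_sequentially)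
    \<comment> \<open>Starting at \<open>Suc n\<close> leaves the predecessor \<open>y n\<close>
      available: the condition at \<open>y n\<close> and \<open>y (Suc m)\<close> absorbs the steps
      by which the gap has grown.\<close>
    have odd_gap: "dist (y (Suc n)) (y (Suc n + 2 * k + 1)) < e" if "n \<ge> N" for n k
    proof (induction k)
      case 0
      then show ?case using N[of "Suc n"] that \<eta>(3) by (simp add: d_def)
    next
      case (Suc k)
      define m where "m = Suc n + 2 * k + 1"
      have IH: "dist (y (Suc n)) (y m) < e" using Suc by (simp add: m_def)
      have small: "dist (y n) (y (Suc n)) < \<eta>" "dist (y m) (y (Suc m)) < \<eta>"
        "dist (y (Suc m)) (y (Suc (Suc m))) < \<eta>"
        using N[of n] N[of m] N[of "Suc m"] that by (auto simp: d_def m_def)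
      have "dist (y (Suc m)) (y (Suc n)) < e + \<eta>"
        using dist_triangle[of "y (Suc n)" "y (Suc m)" "y m"] IH small by (simp add: dist_commute)
      moreover from this have "dist (y n) (y (Suc m)) < e + 2 * \<eta>"
        using dist_triangle[of "y n" "y (Suc m)" "y (Suc n)"] small by (simp add: dist_commute)
      ultimately have "quad (y n) (y (Suc m)) (y (Suc n)) (y (Suc (Suc m))) < e + \<delta>"
        using small \<eta> \<open>e > 0\<close> by (auto simp: quad_def min_less_iff_disj)
      moreover have "odd (n + Suc m)" by (simp add: m_def)
      ultimately have "dist (y (Suc n)) (y (Suc (Suc m))) < e - \<delta>"
        using \<delta>(2) alt by blast
      then show ?case using \<delta>(1) by (simp add: m_def)
    qed
    have close: "dist (y n) (y m) < e'" if "n \<ge> Suc N" "n \<le> m" for n m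
    proof -
      obtain n' where n': "n = Suc n'" "n' \<ge> N" using \<open>n \<ge> Suc N\<close> by (cases n) auto
      consider "m = n" | k where "m = n + 2 * k + 1" | k where "m = Suc (n + 2 * k + 1)"
      proof -
        obtain c where c: "m = n + c" using \<open>n \<le> m\<close> by (auto simp: le_iff_add)
        consider "c = 0" | k where "c = 2 * k + 1" | k where "c = 2 * k + 2"
        proof (cases c)
          case (Suc c')
          then show ?thesis using that by (cases "even c'") (auto elim!: evenE oddE)
        qed (use that in auto)
        then show ?thesis using c that by cases auto
      qed
      then show ?thesis
      proof cases
        case 1
        then show ?thesis using \<open>e' > 0\<close> by simp
      next
        case (2 k)
        then show ?thesis using odd_gap[OF n'(2), of k] n' \<open>e > 0\<close> by (simp add: e_def)
      next
        case (3 k)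
        then show ?thesis
          using odd_gap[OF n'(2), of k] n' N[of "n + 2 * k + 1"] \<eta>(3)
            dist_triangle[of "y n" "y m" "y (n + 2 * k + 1)"]
          by (simp add: e_def d_def)
      qed
    qed
    show "\<exists>M. \<forall>m\<ge>M. \<forall>n\<ge>M. dist (y m) (y n) < e'"
      using close by (metis dist_commute linear)
  qed
qed

section \<open>Coincidence points and common fixed points of two pairs of maps\<close>

locale contractive_pairs =
  fixes K :: "'a::metric_space set" and A B S T :: "'a \<Rightarrow> 'a"
  assumes contr: "contractive (\<lambda>a b s t. \<exists>x\<in>K. \<exists>y\<in>K. a = A x \<and> b = B y \<and> s = S x \<and> t = T y)"
    and TA: "T ` K \<subseteq> A ` K" and SB: "S ` K \<subseteq> B ` K"
begin

text \<open>\<open>quad\<close> is invariant under exchanging the two pairs, so each one-sided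
  result also serves \<open>(B, T)\<close>.\<close>

lemma flip: "contractive_pairs K B A T S"
proof
  show "contractive (\<lambda>a b s t. \<exists>x\<in>K. \<exists>y\<in>K. a = B x \<and> b = A y \<and> s = T x \<and> t = S y)"
    using contr unfolding contractive_def by (metis dist_commute quad_swap)
qed (fact SB, fact TA)

lemma eqI:
  assumes "x \<in> K" "y \<in> K" "quad (A x) (B y) (S x) (T y) \<le> dist (S x) (T y)"
  shows "S x = T y"
  using contractive_eqI[OF contr, of "A x" "B y" "S x" "T y"] assms by blast

lemma jungck_sequence:
  assumes "K \<noteq> {}"
  obtains u v y where "\<And>n. u n \<in> K" "\<And>n. v n \<in> K"
    "\<And>n. y (2 * n) = A (u n)" "\<And>n. y (Suc (2 * n)) = S (u n)"
    "\<And>n. y (Suc (2 * n)) = B (v n)" "\<And>n. y (Suc (Suc (2 * n))) = T (v n)" "Cauchy y"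
proof -
  have "\<forall>x\<in>K. \<exists>w\<in>K. S x = B w" "\<forall>x\<in>K. \<exists>w\<in>K. T x = A w" using TA SB by blast+
  \<comment> \<open>\<open>\<alpha>\<close> chooses a \<open>B\<close>-preimage of
    \<open>S x\<close>, and \<open>\<beta>\<close> an \<open>A\<close>-preimage of
    \<open>T x\<close>.\<close>
  then obtain \<alpha> \<beta> where \<alpha>: "\<And>x. x \<in> K \<Longrightarrow> \<alpha> x \<in> K \<and> S x = B (\<alpha> x)"
    and \<beta>: "\<And>x. x \<in> K \<Longrightarrow> \<beta> x \<in> K \<and> T x = A (\<beta> x)" by metis
  obtain x0 where "x0 \<in> K" using assms by blast
  define u where "u n = ((\<lambda>x. \<beta> (\<alpha> x)) ^^ n) x0" for n
  define v where "v n = \<alpha> (u n)" for n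
  define y where "y n = (if even n then A (u (n div 2)) else B (v (n div 2)))" for n
  have uK: "u n \<in> K" for n by (induction n) (use \<open>x0 \<in> K\<close> \<alpha> \<beta> in \<open>auto simp: u_def\<close>)
  have vK: "v n \<in> K" for n using uK \<alpha> by (simp add: v_def)
  have yA: "y (2 * n) = A (u n)" and yB: "y (Suc (2 * n)) = B (v n)" for n by (simp_all add: y_def)
  have yS: "y (Suc (2 * n)) = S (u n)" for n using yB \<alpha> uK by (simp add: v_def)
  have yT: "y (Suc (Suc (2 * n))) = T (v n)" for n
    using yA[of "Suc n"] \<beta>[OF vK[of n]] by (simp add: u_def v_def)
  define R where "R a b s t \<longleftrightarrow> (\<exists>x\<in>K. \<exists>y\<in>K. a = A x \<and> b = B y \<and> s = S x \<and> t = T y)" for a b s t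
  \<comment> \<open>The Cauchy lemma needs both orders of parity, so the swapped relation is
    added.\<close>
  have contr': "contractive (\<lambda>a b s t. R a b s t \<or> R b a t s)"
    using contr unfolding R_def[symmetric] contractive_def by (metis dist_commute quad_swap)
  have RI: "R (y i) (y j) (y (Suc i)) (y (Suc j))" if "even i" "odd j" for i j
    using that uK vK unfolding R_def by (elim evenE oddE) (metis yA yS yB yT Suc_eq_plus1)
  have "Cauchy y"
    by (rule contractive_alternating_Cauchy[OF contr']) (use RI in \<open>auto simp: even_add\<close>)
  with uK vK yA yS yB yT show thesis by (rule that)
qed

text \<open>At level \<open>e = dist (A u) (S u)\<close>, comparing \<open>u\<close> with
  \<open>v n\<close> eventually keeps \<open>S u\<close> at distance below
  \<open>e - \<delta>\<close> from \<open>T (v n)\<close>, whose limit \<open>A u\<close> is at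
  distance \<open>e\<close>.\<close>

lemma coincidence_of_limit:
  assumes "u \<in> K" "\<And>n. v n \<in> K" "(\<lambda>n. B (v n)) \<longlonglongrightarrow> A u" "(\<lambda>n. T (v n)) \<longlonglongrightarrow> A u"
  shows "S u = A u"
proof (rule ccontr)
  assume "S u \<noteq> A u"
  define e where "e = dist (A u) (S u)"
  have "e > 0" using \<open>S u \<noteq> A u\<close> by (simp add: e_def)
  obtain \<delta> where \<delta>: "\<delta> > 0" "\<And>a b s t. \<exists>x\<in>K. \<exists>y\<in>K. a = A x \<and> b = B y \<and> s = S x \<and> t = T y \<Longrightarrow>
      quad a b s t < e + \<delta> \<Longrightarrow> dist s t < e - \<delta>"
    using contractiveE[OF contr \<open>e > 0\<close>] by metis
  have "\<forall>\<^sub>F n in sequentially. dist (S u) (T (v n)) < e - \<delta>"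
    using tendstoD[OF assms(3) half_gt_zero[OF \<open>e > 0\<close>]] tendstoD[OF assms(4) half_gt_zero[OF \<open>e > 0\<close>]]
  proof eventually_elim
    case (elim n)
    then have "dist (B (v n)) (T (v n)) < e"
      using dist_triangle_half_l[of "B (v n)" "A u" e "T (v n)"] by blast
    moreover have "dist (A u) (B (v n)) < e" "dist (A u) (T (v n)) < e"
      using elim \<open>e > 0\<close> by (simp_all add: dist_commute)
    \<comment> \<open>The entry \<open>dist (A u) (S u)\<close> is exactly \<open>e\<close>; the
      minimum is controlled through \<open>dist (A u) (T (v n))\<close>.\<close>
    ultimately have "quad (A u) (B (v n)) (S u) (T (v n)) < e + \<delta>"
      using \<delta>(1) by (simp add: quad_def min_less_iff_disj flip: e_def)
    with \<delta>(2) assms(1,2) show ?case by blast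
  qed
  then have "\<forall>\<^sub>F n in sequentially. dist (S u) (T (v n)) \<le> e - \<delta>"
    by (rule eventually_mono) simp
  moreover have "(\<lambda>n. dist (S u) (T (v n))) \<longlonglongrightarrow> dist (S u) (A u)"
    using assms(4) by (intro tendsto_intros)
  ultimately have "dist (S u) (A u) \<le> e - \<delta>"
    by (intro tendsto_upperbound) auto
  with \<delta>(1) show False by (simp add: e_def dist_commute)
qed

text \<open>For a \<open>B\<close>-preimage \<open>v\<close> of \<open>S u\<close>, only
  \<open>dist (B v) (T v) = dist (S u) (T v)\<close> survives in \<open>quad\<close>.\<close>

lemma coincidence_transfer:
  assumes "u \<in> K" "S u = A u"
  obtains v where "v \<in> K" "B v = A u" "T v = A u"
proof -
  obtain v where v: "v \<in> K" "S u = B v" using assms SB by blast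
  then have "S u = T v"
    using assms by (intro eqI) (simp_all add: quad_def)
  with v assms show thesis by (intro that[of v]) simp_all
qed

text \<open>Here \<open>quad\<close> collapses to \<open>dist (A x) (B y)\<close>. This yields both
  the fixed point equations and uniqueness.\<close>

lemma coincidence_values_eq:
  assumes "x \<in> K" "y \<in> K" "S x = A x" "T y = B y"
  shows "A x = B y"
  using eqI[OF assms(1,2)] assms by (simp add: quad_def dist_commute)

lemma coincidence_exists:
  assumes "K \<noteq> {}"
    and compl: "complete (T ` K) \<or> complete (S ` K) \<or> complete (A ` K) \<or> complete (B ` K)"
  obtains u v where "u \<in> K" "v \<in> K" "S u = A u" "T v = A u" "B v = A u"
proof -
  interpret flipped: contractive_pairs K B A T S by (rule flip)
  obtain u v y where uv: "\<And>n. u n \<in> K" "\<And>n. v n \<in> K"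
    and y: "\<And>n. y (2 * n) = A (u n)" "\<And>n. y (Suc (2 * n)) = S (u n)"
      "\<And>n. y (Suc (2 * n)) = B (v n)" "\<And>n. y (Suc (Suc (2 * n))) = T (v n)" and "Cauchy y"
    using jungck_sequence[OF assms(1)] by metis
  have sub: "strict_mono (\<lambda>n::nat. 2 * n)" "strict_mono (\<lambda>n::nat. Suc (2 * n))"
    "strict_mono (\<lambda>n::nat. Suc (Suc (2 * n)))" by (auto simp: strict_mono_def)
  \<comment> \<open>Only a subsequence need lie in the complete image; the Cauchy property carries
    its limit over to \<open>y\<close>.\<close>
  have limit: "\<exists>z\<in>C. y \<longlonglongrightarrow> z" if C: "complete C" "\<And>n. y (f n) \<in> C" and f: "strict_mono f" for C and f :: "nat \<Rightarrow> nat"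
  proof -
    have "Cauchy (y \<circ> f)" using Cauchy_subseq_Cauchy[OF \<open>Cauchy y\<close> f] .
    then obtain z where "z \<in> C" "(y \<circ> f) \<longlonglongrightarrow> z"
      using C unfolding complete_def by (metis comp_apply)
    then show ?thesis
      using Cauchy_converges_subseq[OF \<open>Cauchy y\<close> f] by blast
  qed
  from compl have "\<exists>z\<in>A ` K \<union> B ` K. y \<longlonglongrightarrow> z"
  proof (elim disjE)
    assume "complete (T ` K)"
    then have "\<exists>z\<in>T ` K. y \<longlonglongrightarrow> z"
      by (rule limit[OF _ _ sub(3)]) (use uv y in \<open>metis imageI\<close>)
    then show ?thesis using TA by blast
  next
    assume "complete (S ` K)"
    then have "\<exists>z\<in>S ` K. y \<longlonglongrightarrow> z"
      by (rule limit[OF _ _ sub(2)]) (use uv y in \<open>metis imageI\<close>)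
    then show ?thesis using SB by blast
  next
    assume "complete (A ` K)"
    from limit[OF this _ sub(1)] show ?thesis using uv y by auto
  next
    assume "complete (B ` K)"
    from limit[OF this _ sub(2)] show ?thesis using uv y(3) by auto
  qed
  then obtain z where z: "z \<in> A ` K \<union> B ` K" "y \<longlonglongrightarrow> z" by blast
  have lims: "(\<lambda>n. A (u n)) \<longlonglongrightarrow> z" "(\<lambda>n. S (u n)) \<longlonglongrightarrow> z"
    "(\<lambda>n. B (v n)) \<longlonglongrightarrow> z" "(\<lambda>n. T (v n)) \<longlonglongrightarrow> z"
    using LIMSEQ_subseq_LIMSEQ[OF z(2) sub(1)] LIMSEQ_subseq_LIMSEQ[OF z(2) sub(2)]
      LIMSEQ_subseq_LIMSEQ[OF z(2) sub(3)] unfolding comp_def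
    by (simp_all only: y(1,4) flip: y(2,3))
  from z(1) show thesis
  proof
    assume "z \<in> A ` K"
    then obtain x where "x \<in> K" "z = A x" by blast
    with lims uv have "S x = A x" by (intro coincidence_of_limit) simp_all
    with \<open>x \<in> K\<close> show thesis by (metis coincidence_transfer that)
  next
    assume "z \<in> B ` K"
    then obtain x where "x \<in> K" "z = B x" by blast
    with lims uv have "T x = B x" by (intro flipped.coincidence_of_limit) simp_all
    with \<open>x \<in> K\<close> show thesis by (metis flipped.coincidence_transfer that)
  qed
qed

theorem unique_common_fixed_point:
  assumes "K \<noteq> {}" "A ` K \<subseteq> K"
    and wc: "weakly_compatible_on K A S" "weakly_compatible_on K B T"
    and compl: "complete (T ` K) \<or> complete (S ` K) \<or> complete (A ` K) \<or> complete (B ` K)"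
  shows "\<exists>!z. z \<in> K \<and> A z = z \<and> B z = z \<and> S z = z \<and> T z = z"
proof -
  obtain u v where uv: "u \<in> K" "v \<in> K" "S u = A u" "T v = A u" "B v = A u"
    using coincidence_exists[OF assms(1) compl] by metis
  define z where "z = A u"
  have "z \<in> K" using uv assms(2) by (auto simp: z_def)
  \<comment> \<open>Both pairs take the common value \<open>z\<close> at \<open>u\<close> and
    \<open>v\<close>; commuting there makes \<open>z\<close> itself a coincidence point of each
    pair.\<close>
  have "S z = A z" "T z = B z"
    using wc uv unfolding weakly_compatible_on_def z_def by metis+
  have "A z = z"
    using coincidence_values_eq[OF \<open>z \<in> K\<close> uv(2) \<open>S z = A z\<close>] uv by (simp add: z_def)
  moreover have "B z = z"
    using coincidence_values_eq[OF uv(1) \<open>z \<in> K\<close> uv(3) \<open>T z = B z\<close>] by (simp add: z_def)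
  ultimately show ?thesis
    using \<open>z \<in> K\<close> \<open>S z = A z\<close> \<open>T z = B z\<close> coincidence_values_eq
    by (intro ex1I[of _ z]) metis+
qed

end

section \<open>Monotonicity, positivity and continuity of the bracket\<close>

lemma rpow_nonneg: "0 \<le> rpow x a"
  by (simp add: rpow_def)

lemma rpow_mono: "0 \<le> x \<Longrightarrow> x \<le> y \<Longrightarrow> 0 \<le> a \<Longrightarrow> rpow x a \<le> rpow y a"
  by (simp add: rpow_def powr_mono2)

lemma bracket_nonneg: "0 \<le> bracket p q r l a b"
  by (simp add: bracket_def rpow_nonneg)

lemma bracket_mono:
  assumes "p > 0" "l > 0" "r \<ge> 0" "q \<ge> 0" "0 \<le> a" "a \<le> a'" "0 \<le> b" "b \<le> b'"
  shows "bracket p q r l a b \<le> bracket p q r l a' b'"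
  unfolding bracket_def using assms
  by (intro rpow_mono add_mono mult_left_mono add_nonneg_nonneg mult_nonneg_nonneg)
     (simp_all add: rpow_nonneg)

lemma bracket_pos:
  assumes "r \<ge> 0" "0 < a"
  shows "0 < bracket p q r l a b"
proof -
  have "0 < rpow a p + r * rpow b q"
    using assms by (intro add_pos_nonneg mult_nonneg_nonneg rpow_nonneg) (simp_all add: rpow_def)
  then show ?thesis by (simp add: bracket_def rpow_def)
qed

text \<open>At \<open>e > 0\<close> the base of every power, including the inner sum, is
  positive.\<close>

lemma isCont_bracket_diagonal:
  assumes "r \<ge> 0" "0 < e"
  shows "isCont (\<lambda>t. bracket p q r l t t) e"
proof -
  have *: "isCont (\<lambda>t. rpow (f t) a) e" if "isCont f e" "0 < f e" for f :: "real \<Rightarrow> real" and a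
    unfolding rpow_def using that by (cases "a = 0") (auto intro!: continuous_intros)
  have "0 < rpow e p + r * rpow e q"
    using assms by (intro add_pos_nonneg mult_nonneg_nonneg rpow_nonneg) (simp_all add: rpow_def)
  then show ?thesis
    unfolding bracket_def using assms by (intro * continuous_intros) auto
qed

section \<open>Reduction of the bracket inequality to the Meir-Keeler condition\<close>

theorem theorem2p5:
  fixes K :: "'a::metric_space set"
    and A B S T :: "'a \<Rightarrow> 'a"
  assumes "K \<noteq> {}"
    and "A ` K \<subseteq> K" and "B ` K \<subseteq> K" and "S ` K \<subseteq> K" and "T ` K \<subseteq> K"
    and "\<exists>\<phi>\<in>Phi. \<exists>p>0. \<exists>l>0. \<exists>r\<ge>0. \<exists>q\<ge>0. \<forall>x\<in>K. \<forall>y\<in>K.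
      bracket p q r l (dist (S x) (T y)) (dist (S x) (T y)) \<le>
      \<phi> (Max {bracket p q r l (dist (A x) (B y)) (dist (A x) (S x)),
              bracket p q r l (dist (A x) (B y)) (dist (B y) (T y)),
              bracket p q r l (dist (A x) (S x)) (dist (B y) (T y)),
              bracket p q r l (dist (B y) (T y)) (dist (A x) (S x)),
              min (bracket p q r l (dist (B y) (S x)) (dist (A x) (S x)))
                  (bracket p q r l (dist (A x) (T y)) (dist (B y) (T y))),
              min (bracket p q r l (dist (B y) (S x)) (dist (B y) (T y)))
                  (bracket p q r l (dist (A x) (T y)) (dist (A x) (S x)))})"
    and "weakly_compatible_on K A S" and "weakly_compatible_on K B T"
    and "T ` K \<subseteq> A ` K" and "S ` K \<subseteq> B ` K"
    and "complete (T ` K) \<or> complete (S ` K) \<or> complete (A ` K) \<or> complete (B ` K)"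
  shows "\<exists>!z. z \<in> K \<and> A z = z \<and> B z = z \<and> S z = z \<and> T z = z"
proof -
  let ?Max = "\<lambda>g x y. Max {g (dist (A x) (B y)) (dist (A x) (S x)),
              g (dist (A x) (B y)) (dist (B y) (T y)),
              g (dist (A x) (S x)) (dist (B y) (T y)),
              g (dist (B y) (T y)) (dist (A x) (S x)),
              min (g (dist (B y) (S x)) (dist (A x) (S x)))
                  (g (dist (A x) (T y)) (dist (B y) (T y))),
              min (g (dist (B y) (S x)) (dist (B y) (T y)))
                  (g (dist (A x) (T y)) (dist (A x) (S x)))} :: real"
  obtain \<phi> p l r q where "\<phi> \<in> Phi" and pos: "p > 0" "l > 0" "r \<ge> 0" "q \<ge> 0"
    and ineq: "\<And>x y. x \<in> K \<Longrightarrow> y \<in> K \<Longrightarrow>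
      bracket p q r l (dist (S x) (T y)) (dist (S x) (T y)) \<le> \<phi> (?Max (bracket p q r l) x y)"
    using assms(6) by (elim bexE exE conjE) metis
  define g where "g = bracket p q r l"
  define h where "h t = g t t" for t
  have mono: "mono_on {0..} \<phi>" and cont: "continuous_on {0..} \<phi>"
    and less: "\<And>t. t > 0 \<Longrightarrow> \<phi> t < t" using \<open>\<phi> \<in> Phi\<close> by (auto simp: Phi_def)
  have g_mono: "g a b \<le> g a' b'" if "0 \<le> a" "a \<le> a'" "0 \<le> b" "b \<le> b'" for a b a' b'
    unfolding g_def using pos that by (rule bracket_mono)
  have g_nonneg: "0 \<le> g a b" for a b by (simp add: g_def bracket_nonneg)
  \<comment> \<open>Each inner minimum has one branch starting with \<open>dist (B y) (S x)\<close>
    and one with \<open>dist (A x) (T y)\<close>; at least one of these is at most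
    \<open>quad\<close>.\<close>
  have Max_le: "?Max g x y \<le> h (quad (A x) (B y) (S x) (T y))" for x y
  proof -
    let ?m = "quad (A x) (B y) (S x) (T y)"
    have m: "dist (A x) (B y) \<le> ?m" "dist (A x) (S x) \<le> ?m" "dist (B y) (T y) \<le> ?m"
      "dist (B y) (S x) \<le> ?m \<or> dist (A x) (T y) \<le> ?m"
      by (auto simp: quad_def)
    then show ?thesis
      unfolding h_def by (auto simp: min_le_iff_disj intro!: g_mono)
  qed
  have "contractive (\<lambda>a b s t. \<exists>x\<in>K. \<exists>y\<in>K. a = A x \<and> b = B y \<and> s = S x \<and> t = T y)"
    unfolding contractive_def
  proof (intro allI impI)
    fix e :: real assume "e > 0"
    have h_pos: "0 < h e" using pos \<open>e > 0\<close> by (simp add: h_def g_def bracket_pos)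
    have h_cont: "isCont h e"
      using isCont_bracket_diagonal[OF pos(3) \<open>e > 0\<close>] unfolding h_def g_def .
    have "isCont \<phi> (h e)"
      using continuous_on_subset[OF cont, of "{0<..}"] h_pos
      by (simp add: continuous_on_eq_continuous_at subset_iff)
    then have "isCont (\<lambda>t. \<phi> (h t)) e"
      using h_cont by (rule isCont_o2[rotated])
    \<comment> \<open>The limit is positive since \<open>\<phi> (h e) < h e\<close>, so one small
      \<open>\<delta>\<close> provides the margin on both sides of \<open>e\<close>.\<close>
    have "((\<lambda>\<delta>. h (e - \<delta>) - \<phi> (h (e + \<delta>))) \<longlongrightarrow> h e - \<phi> (h e)) (at_right 0)"
    proof (rule tendsto_diff)
      show "((\<lambda>\<delta>. h (e - \<delta>)) \<longlongrightarrow> h e) (at_right 0)"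
        by (rule isCont_tendsto_compose[OF h_cont]) (auto intro!: tendsto_eq_intros)
      show "((\<lambda>\<delta>. \<phi> (h (e + \<delta>))) \<longlongrightarrow> \<phi> (h e)) (at_right 0)"
        by (rule isCont_tendsto_compose[OF \<open>isCont (\<lambda>t. \<phi> (h t)) e\<close>]) (auto intro!: tendsto_eq_intros)
    qed
    then have "\<forall>\<^sub>F \<delta> in at_right 0. 0 < h (e - \<delta>) - \<phi> (h (e + \<delta>))"
      using less[OF h_pos] by (intro order_tendstoD(1)) auto
    \<comment> \<open>\<open>\<delta> < e\<close> keeps \<open>e - \<delta>\<close> in the range
      where \<open>g\<close> is known to be monotone.\<close>
    moreover have "\<forall>\<^sub>F \<delta> in at_right 0. \<delta> \<in> {0<..<e}"
      using \<open>e > 0\<close> by (rule eventually_at_right_real)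
    ultimately have "\<forall>\<^sub>F \<delta> in at_right 0. 0 < \<delta> \<and> \<delta> < e \<and> \<phi> (h (e + \<delta>)) < h (e - \<delta>)"
      by eventually_elim auto
    then obtain \<delta> where \<delta>: "0 < \<delta>" "\<delta> < e" "\<phi> (h (e + \<delta>)) < h (e - \<delta>)"
      using eventually_happens'[OF trivial_limit_at_right_real] by blast
    have "dist (S x) (T y) < e - \<delta>"
      if xy: "x \<in> K" "y \<in> K" and quad: "quad (A x) (B y) (S x) (T y) < e + \<delta>" for x y
    proof (rule ccontr)
      assume "\<not> dist (S x) (T y) < e - \<delta>"
      then have "h (e - \<delta>) \<le> h (dist (S x) (T y))"
        using \<delta> unfolding h_def by (intro g_mono) auto
      also have "\<dots> \<le> \<phi> (?Max g x y)"
        using ineq[OF xy] by (simp only: h_def g_def)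
      also have "\<dots> \<le> \<phi> (h (e + \<delta>))"
      proof (rule mono_onD[OF mono])
        show "?Max g x y \<in> {0..}" by (auto simp: le_max_iff_disj g_nonneg)
        show "h (e + \<delta>) \<in> {0..}" by (simp add: h_def g_nonneg)
        have "h (quad (A x) (B y) (S x) (T y)) \<le> h (e + \<delta>)"
          unfolding h_def using quad by (intro g_mono) (auto simp: quad_nonneg)
        with Max_le show "?Max g x y \<le> h (e + \<delta>)" by (rule order_trans)
      qed
      finally show False using \<delta>(3) by simp
    qed
    with \<delta>(1) show "\<exists>\<delta>>0. \<forall>a b s t. (\<exists>x\<in>K. \<exists>y\<in>K. a = A x \<and> b = B y \<and> s = S x \<and> t = T y) \<longrightarrow>
        quad a b s t < e + \<delta> \<longrightarrow> dist s t < e - \<delta>"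
      by blast
  qed
  then interpret contractive_pairs K A B S T
    using assms by unfold_locales
  show ?thesis
    using assms by (intro unique_common_fixed_point)
qed

end
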